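(* Let $f:\mathbb{C}\to\mathbb{C}$ be a polynomial of degree $d>1$ with Julia set $J$. Given a box chain model $\Gamma=(\mathcal V,\mathcal E)$ of $f$ on $J$ and $L>0$, the Handicap Hedging Algorithm either (1) constructs a box metric for which $\Gamma$ is box expansive by $L$, or (2) produces a cycle of $\Gamma$ which is an obstruction, showing there exists no box metric for which $\Gamma$ is box expansive by $L$.
   Context: The Julia set $J$ of a polynomial $f$ of degree $>1$ is the topological boundary of the set of points with bounded orbits. A closed box in $\mathbb{C}=\mathbb{R}^2$ is a product $[a,b]\times[c,d]$ of closed intervals. $\mathcal N(S,r)$ denotes the open $r$-neighborhood of $S$. Box chain model of $f$ on $J$: a directed graph $\Gamma=(\mathcal V,\mathcal E)$ whose vertex set $\mathcal V=\{B_k\}_{k=1}^N$ is a finite collection of closed boxes in $\mathbb{C}$ with disjoint interiors and union containing $J$, such that for some $\delta>0$, $\mathcal E\supset\{(k,j): f(B_k)\cap\mathcal N(B_j,\delta)\ne\emptyset\}$, and such that $\Gamma$ is strongly connected. Here $(k,j)\in\mathcal E$ means there is an edge from $B_k$ to $B_j$. Multiplier of $B_k$: $\lambda_k=\min\{|f'(z)|:z\in B_k\}$. Box metric: a family $\Phi=\{\varphi_k\}_{k=1}^N$ of positive constants (handicaps), one per box, inducing norms $|\mathbf v|_k=\varphi_k|\mathbf v|$ for $\mathbf v\in T_zB_k$ ($|\cdot|$ euclidean). $\Gamma$ is box expansive by $L$ for $\Phi$ if $|D_zf(\mathbf v)|_j\ge L|\mathbf v|_k$ for all $(k,j)\in\mathcal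 E$, $z\in B_k$, $\mathbf v\in T_zB_k$. Handicap Hedging Algorithm. Put edge weights $\xi_{k,j}=L/\lambda_k$ for $(k,j)\in\mathcal E$. Choose a root vertex $v_0$ and a spanning arborescence $\Gamma_0$ of $\Gamma$ rooted at $v_0$ (a spanning tree in which every other vertex is reached from $v_0$ by a unique simple directed path). Set $\varphi_{v_0}=1$ and, for each edge $(u,w)$ of $\Gamma_0$, going outward from the root, $\varphi_w=\xi_{u,w}\varphi_u$. Then add the remaining edges of $\Gamma$ one at a time, giving $\Gamma_0\subset\Gamma_1\subset\dots\subset\Gamma_M=\Gamma$; when edge $(a,b)$ is added to form $\Gamma_n$, call Hedge$(a,b,a)$, where the recursive routine Hedge$(u,v,a)$ is: - if $\varphi_v\ge\xi_{u,v}\varphi_u$, return 1; - else if $v=a$, return 0; - else set $\varphi_v:=\xi_{u,v}\varphi_u$, and for each $w$ with $(v,w)$ an edge of $\Gamma_n$ call Hedge$(v,w,a)$, returning 0 if that call returns 0; return 1 if all these calls return 1. If some call Hedge$(a,b,a)$ returns 0, the algorithm stops, having found the cycle $a\to b\to\cdots\to u\to a$ along which the recursive calls were made. If all calls return 1, the current values $\{\varphi_k\}$ are the constructed box metric.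
   Formalization: The formal theorem assumes that the multiplier λ_k is nonzero for every box B_k with an outgoing edge, since otherwise the edge weights L/λ_k used by the algorithm are undefined. *)

theory Defs
  imports
    "HOL-Analysis.Analysis"
    "HOL-Computational_Algebra.Polynomial"
    "Graph_Theory.Digraph_Component"
begin

section \<open>Julia sets and box chain models\<close>

definition julia_set :: "(complex \<Rightarrow> complex) \<Rightarrow> complex set" where
  "julia_set f = frontier {z. bounded (range (\<lambda>n. (f ^^ n) z))}"

text \<open>For complex corners, \<open>cbox a b\<close> is \<open>[Re a, Re b] \<times> [Im a, Im b]\<close>.\<close>

definition closed_box :: "complex set \<Rightarrow> bool" where
  "closed_box S \<longleftrightarrow> (\<exists>a b. Re a \<le> Re b \<and> Im a \<le> Im b \<and> S = cbox a b)"

definition open_nbhd :: "complex set \<Rightarrow> real \<Rightarrow> complex set" where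
  "open_nbhd S r = (\<Union>x\<in>S. ball x r)"

text \<open>
  The boxes are \<open>B 1, \<dots>, B N\<close>; the vertices of the digraph are their indices.
\<close>

definition box_chain_model ::
  "(complex \<Rightarrow> complex) \<Rightarrow> nat \<Rightarrow> (nat \<Rightarrow> complex set) \<Rightarrow> nat pair_pre_digraph \<Rightarrow> bool" where
  "box_chain_model f N B \<Gamma> \<longleftrightarrow>
     pverts \<Gamma> = {1..N} \<and> pair_wf_digraph \<Gamma> \<and>
     (\<forall>k\<in>{1..N}. closed_box (B k)) \<and>
     (\<forall>k\<in>{1..N}. \<forall>j\<in>{1..N}. k \<noteq> j \<longrightarrow> interior (B k) \<inter> interior (B j) = {}) \<and>
     julia_set f \<subseteq> (\<Union>k\<in>{1..N}. B k) \<and>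
     (\<exists>\<delta>>0. {(k, j). k \<in> {1..N} \<and> j \<in> {1..N} \<and> f ` B k \<inter> open_nbhd (B j) \<delta> \<noteq> {}} \<subseteq> parcs \<Gamma>) \<and>
     strongly_connected (with_proj \<Gamma>)"

definition multiplier :: "(complex \<Rightarrow> complex) \<Rightarrow> complex set \<Rightarrow> real" where
  "multiplier f S = (LEAST x. x \<in> (\<lambda>z. cmod (deriv f z)) ` S)"


section \<open>Box metrics and expansion\<close>

definition box_metric :: "nat set \<Rightarrow> (nat \<Rightarrow> real) \<Rightarrow> bool" where
  "box_metric V \<phi> \<longleftrightarrow> (\<forall>k\<in>V. \<phi> k > 0)"

definition box_norm :: "(nat \<Rightarrow> real) \<Rightarrow> nat \<Rightarrow> complex \<Rightarrow> real" where
  "box_norm \<phi> k v = \<phi> k * norm v"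

text \<open>The edge set \<open>E\<close> is a separate argument so that expansion also makes sense along a subgraph.\<close>

definition box_expansive ::
  "(complex \<Rightarrow> complex) \<Rightarrow> (nat \<Rightarrow> complex set) \<Rightarrow> (nat \<times> nat) set \<Rightarrow> real \<Rightarrow> (nat \<Rightarrow> real) \<Rightarrow> bool" where
  "box_expansive f B E L \<phi> \<longleftrightarrow>
     (\<forall>(k, j)\<in>E. \<forall>z\<in>B k. \<forall>v. box_norm \<phi> j (frechet_derivative f (at z) v) \<ge> L * box_norm \<phi> k v)"

text \<open>
  A cycle, given as the list of its edges, is an obstruction if its own edges already
  rule out every choice of handicaps.
\<close>

definition obstruction ::
  "(complex \<Rightarrow> complex) \<Rightarrow> (nat \<Rightarrow> complex set) \<Rightarrow> nat pair_pre_digraph \<Rightarrow> real \<Rightarrow> (nat \<times> nat) list \<Rightarrow> bool" where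
  "obstruction f B \<Gamma> L c \<longleftrightarrow>
     pre_digraph.cycle (with_proj \<Gamma>) c \<and>
     \<not> (\<exists>\<phi>. box_metric (pverts \<Gamma>) \<phi> \<and> box_expansive f B (set c) L \<phi>)"


section \<open>The Handicap Hedging Algorithm\<close>

subsection \<open>Hedging\<close>

text \<open>
  The routine \<open>Hedge(u,v,a)\<close> acts on the handicaps, a global variable. \<open>Return1 \<phi>\<close> is the
  return value 1 with handicaps \<open>\<phi>\<close>; \<open>Return0 c\<close> is the return value 0, where \<open>c\<close> lists the
  edges of the pending calls, from the current call down to the one which reached \<open>a\<close>.
\<close>

datatype hedge_result = Return1 "nat \<Rightarrow> real" | Return0 "(nat \<times> nat) list"

text \<open>Make the calls \<open>h w\<close> for \<open>w\<close> in a list, up to the first one that returns 0.\<close>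

primrec for_each ::
  "(nat \<Rightarrow> (nat \<Rightarrow> real) \<Rightarrow> hedge_result option) \<Rightarrow> nat list \<Rightarrow> (nat \<Rightarrow> real) \<Rightarrow> hedge_result option" where
  "for_each h [] \<phi> = Some (Return1 \<phi>)"
| "for_each h (w # ws) \<phi> =
     Option.bind (h w \<phi>) (\<lambda>r. case r of
       Return1 \<psi> \<Rightarrow> for_each h ws \<psi>
     | Return0 c \<Rightarrow> Some (Return0 c))"

lemma for_each_mono [partial_function_mono]:
  assumes "\<And>w \<psi>. mono_option (\<lambda>h. B h w \<psi>)"
  shows "mono_option (\<lambda>h. for_each (B h) ws \<phi>)"
proof (induction ws arbitrary: \<phi>)
  case Nil
  show ?case by (simp add: option.const_mono)
next
  case (Cons w ws)
  have "mono_option (\<lambda>h. case r of Return1 \<psi> \<Rightarrow> for_each (B h) ws \<psi>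
      | Return0 c \<Rightarrow> Some (Return0 c))" for r
    by (cases r) (simp_all add: Cons.IH option.const_mono)
  then show ?case
    unfolding for_each.simps by (intro bind_mono assms)
qed

text \<open>
  \<open>ord \<phi> v\<close> is the order in which the loop visits the successors of \<open>v\<close>. It may depend on the
  current handicaps, hence may change from one visit of \<open>v\<close> to the next. The result \<open>None\<close>
  means that the recursion does not terminate.
\<close>

partial_function (option) hedge ::
  "(nat \<Rightarrow> nat \<Rightarrow> real) \<Rightarrow> ((nat \<Rightarrow> real) \<Rightarrow> nat \<Rightarrow> nat list) \<Rightarrow> nat \<Rightarrow> nat \<Rightarrow> nat \<Rightarrow>
     (nat \<Rightarrow> real) \<Rightarrow> hedge_result option" where
  "hedge \<xi> ord u v a \<phi> =
     (if \<phi> v \<ge> \<xi> u v * \<phi> u then Some (Return1 \<phi>)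
      else if v = a then Some (Return0 [(u, v)])
      else let \<phi>' = \<phi>(v := \<xi> u v * \<phi> u) in
        Option.bind (for_each (\<lambda>w \<psi>. hedge \<xi> ord v w a \<psi>) (ord \<phi>' v) \<phi>') (\<lambda>r. case r of
          Return1 \<psi> \<Rightarrow> Some (Return1 \<psi>)
        | Return0 c \<Rightarrow> Some (Return0 ((u, v) # c))))"

subsection \<open>Initialisation along the arborescence\<close>

text \<open>
  Cycles of length at least 3 of the symmetric digraph are the cycles of the underlying
  undirected graph; a loop or a pair of antiparallel arcs is excluded by \<open>asym\<close>. The library's
  \<open>tree\<close> only excludes directed cycles.
\<close>

definition undirected_tree :: "nat pair_pre_digraph \<Rightarrow> bool" where
  "undirected_tree T \<longleftrightarrow>
     Digraph_Component.connected (with_proj T) \<and> asym (parcs T) \<and>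
     \<not> (\<exists>p. pre_digraph.cycle (with_proj (mk_symmetric (with_proj T))) p \<and> length p \<ge> 3)"

definition spanning_arborescence :: "nat pair_pre_digraph \<Rightarrow> nat \<Rightarrow> nat pair_pre_digraph \<Rightarrow> bool" where
  "spanning_arborescence \<Gamma> v0 T \<longleftrightarrow>
     v0 \<in> pverts \<Gamma> \<and> spanning (with_proj T) (with_proj \<Gamma>) \<and> undirected_tree T \<and>
     (\<forall>w\<in>pverts \<Gamma> - {v0}. \<exists>!p. pre_digraph.apath (with_proj T) v0 p w)"

text \<open>The edges in \<open>ts\<close> are listed outward: each starts at the root or at an endpoint of an earlier edge.\<close>

definition outward :: "nat \<Rightarrow> (nat \<times> nat) list \<Rightarrow> bool" where
  "outward v0 ts \<longleftrightarrow> (\<forall>i<length ts. fst (ts ! i) \<in> insert v0 (snd ` set (take i ts)))"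

definition init_handicaps :: "(nat \<Rightarrow> nat \<Rightarrow> real) \<Rightarrow> nat \<Rightarrow> (nat \<times> nat) list \<Rightarrow> nat \<Rightarrow> real" where
  "init_handicaps \<xi> v0 ts =
     fold (\<lambda>(u, w) \<phi>. \<phi>(w := \<xi> u w * \<phi> u)) ts ((\<lambda>_. undefined)(v0 := 1))"

subsection \<open>Adding the remaining edges\<close>

fun add_edges ::
  "(nat \<Rightarrow> nat \<Rightarrow> real) \<Rightarrow> ((nat \<times> nat) set \<Rightarrow> (nat \<Rightarrow> real) \<Rightarrow> nat \<Rightarrow> nat list) \<Rightarrow>
     (nat \<times> nat) set \<Rightarrow> (nat \<times> nat) list \<Rightarrow> (nat \<Rightarrow> real) \<Rightarrow> hedge_result option" where
  "add_edges \<xi> ord E [] \<phi> = Some (Return1 \<phi>)"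
| "add_edges \<xi> ord E ((a, b) # es) \<phi> =
     (let E' = insert (a, b) E in
      Option.bind (hedge \<xi> (ord E') a b a \<phi>) (\<lambda>r. case r of
        Return1 \<psi> \<Rightarrow> add_edges \<xi> ord E' es \<psi>
      | Return0 c \<Rightarrow> Some (Return0 c)))"

text \<open>
  All choices left open by the algorithm: the root \<open>v0\<close>, the arborescence with an outward
  enumeration \<open>ts\<close> of its edges, the order \<open>es\<close> of the remaining edges, and for every stage
  (given by its edge set \<open>E\<close>) the order of the loops in the hedging routine.
\<close>

definition hha_choices ::
  "nat pair_pre_digraph \<Rightarrow> nat \<Rightarrow> (nat \<times> nat) list \<Rightarrow> (nat \<times> nat) list \<Rightarrow>
     ((nat \<times> nat) set \<Rightarrow> (nat \<Rightarrow> real) \<Rightarrow> nat \<Rightarrow> nat list) \<Rightarrow> bool" where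
  "hha_choices \<Gamma> v0 ts es ord \<longleftrightarrow>
     spanning_arborescence \<Gamma> v0 \<lparr>pverts = pverts \<Gamma>, parcs = set ts\<rparr> \<and>
     distinct ts \<and> outward v0 ts \<and>
     distinct es \<and> set es = parcs \<Gamma> - set ts \<and>
     (\<forall>E \<phi> v. E \<subseteq> parcs \<Gamma> \<longrightarrow> distinct (ord E \<phi> v) \<and> set (ord E \<phi> v) = E `` {v})"

definition handicap_hedging ::
  "(complex \<Rightarrow> complex) \<Rightarrow> (nat \<Rightarrow> complex set) \<Rightarrow> real \<Rightarrow> nat \<Rightarrow> (nat \<times> nat) list \<Rightarrow> (nat \<times> nat) list \<Rightarrow>
     ((nat \<times> nat) set \<Rightarrow> (nat \<Rightarrow> real) \<Rightarrow> nat \<Rightarrow> nat list) \<Rightarrow> hedge_result option" where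
  "handicap_hedging f B L v0 ts es ord =
     (let \<xi> = (\<lambda>k j. L / multiplier f (B k))
      in add_edges \<xi> ord (set ts) es (init_handicaps \<xi> v0 ts))"

end

theory Submission
  imports Defs
begin

text \<open>
  Write \<open>\<xi> k j = L / \<lambda> k\<close>. Since \<open>\<lambda> k\<close> is attained on the box, expansion by \<open>L\<close> means
  \<open>\<xi> k j * \<phi> k \<le> \<phi> j\<close> on every edge. The arborescence gives every vertex one parent, so the initial
  handicaps satisfy this on its edges. When an edge \<open>(a, b)\<close> is added, hedging raises each handicap just
  enough along a chain from \<open>a\<close>; the inequalities already achieved prevent the chain from meeting itself
  before it returns to \<open>a\<close>. Hence hedging terminates, and it either restores all inequalities or closes a
  simple cycle along which the product of the \<open>\<xi>\<close> exceeds 1. Multiplying the inequalities along such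
  a cycle shows that no positive handicaps satisfy them.
\<close>


section \<open>Edge inequalities and the hedging of one added edge\<close>

definition feasible :: "(nat \<Rightarrow> nat \<Rightarrow> real) \<Rightarrow> (nat \<times> nat) set \<Rightarrow> (nat \<Rightarrow> real) \<Rightarrow> bool" where
  "feasible \<xi> E \<phi> \<longleftrightarrow> (\<forall>(x, y)\<in>E. \<xi> x y * \<phi> x \<le> \<phi> y)"

lemma feasibleD: "feasible \<xi> E \<phi> \<Longrightarrow> (x, y) \<in> E \<Longrightarrow> \<xi> x y * \<phi> x \<le> \<phi> y"
  by (auto simp: feasible_def)

text \<open>Later calls of the loop change the handicaps again, so the goal \<open>Q w\<close>
  reached by one call has to survive the following ones. This is why every call must preserve each
  \<open>Q w'\<close> and not only the invariant \<open>I\<close>. \<open>R\<close> describes the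
  chain reported by a failing call.\<close>

lemma for_each_invariant:
  assumes "I \<phi>"
    and "\<And>w \<psi>. w \<in> set ws \<Longrightarrow> I \<psi> \<Longrightarrow> \<exists>r. h w \<psi> = Some r \<and>
      (case r of Return1 \<psi>' \<Rightarrow> I \<psi>' \<and> Q w \<psi>' \<and> (\<forall>w'. Q w' \<psi> \<longrightarrow> Q w' \<psi>') | Return0 c \<Rightarrow> R c)"
  shows "\<exists>r. for_each h ws \<phi> = Some r \<and>
    (case r of Return1 \<psi>' \<Rightarrow> I \<psi>' \<and> (\<forall>w\<in>set ws. Q w \<psi>') \<and> (\<forall>w'. Q w' \<phi> \<longrightarrow> Q w' \<psi>') | Return0 c \<Rightarrow> R c)"
  using assms
proof (induction ws arbitrary: \<phi>)
  case Nil
  then show ?case by simp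
next
  case (Cons w ws)
  obtain r where r: "h w \<phi> = Some r" "case r of Return1 \<psi>' \<Rightarrow> I \<psi>' \<and> Q w \<psi>' \<and> (\<forall>w'. Q w' \<phi> \<longrightarrow> Q w' \<psi>') | Return0 c \<Rightarrow> R c"
    using Cons.prems by (meson list.set_intros(1))
  show ?case
  proof (cases r)
    case (Return1 \<psi>)
    obtain r' where r': "for_each h ws \<psi> = Some r'"
      "case r' of Return1 \<psi>' \<Rightarrow> I \<psi>' \<and> (\<forall>w\<in>set ws. Q w \<psi>') \<and> (\<forall>w'. Q w' \<psi> \<longrightarrow> Q w' \<psi>') | Return0 c \<Rightarrow> R c"
      using Cons.IH[of \<psi>] Cons.prems(2) r Return1 by (metis (no_types, lifting) hedge_result.case(1) list.set_intros(2))
    then show ?thesis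
      using r Return1 by (cases r') auto
  next
    case (Return0 c)
    then show ?thesis using r by simp
  qed
qed

text \<open>The situation just after an edge leaving \<open>a\<close> was added: \<open>E\<close>
  contains that edge and \<open>\<phi>\<^sub>0\<close> holds the handicaps before hedging.
  Feasibility is asked only of edges not leaving \<open>a\<close>, since the recursion stops on
  reaching \<open>a\<close> and never loops over its successors; the other edges at \<open>a\<close>
  are recovered afterwards.\<close>

locale hedging =
  fixes \<xi> :: "nat \<Rightarrow> nat \<Rightarrow> real" and V :: "nat set" and E :: "(nat \<times> nat) set"
    and a :: nat and \<phi>\<^sub>0 :: "nat \<Rightarrow> real" and succs :: "(nat \<Rightarrow> real) \<Rightarrow> nat \<Rightarrow> nat list"
  assumes finite_V: "finite V" and E_subset: "E \<subseteq> V \<times> V"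
    and weight_pos: "\<And>x y. (x, y) \<in> E \<Longrightarrow> \<xi> x y > 0"
    and handicap_pos: "\<And>x. x \<in> V \<Longrightarrow> \<phi>\<^sub>0 x > 0"
    and feasible_0: "feasible \<xi> {e \<in> E. fst e \<noteq> a} \<phi>\<^sub>0"
    and set_succs: "\<And>\<phi> v. set (succs \<phi> v) = E `` {v}"
begin

text \<open>Serves both as loop invariant and as the effect of a successful call. \<open>P\<close>
  stands for the tails of the pending calls; the edges leaving \<open>P\<close> are exempt because
  their loops are not finished.\<close>

definition admissible :: "nat set \<Rightarrow> (nat \<Rightarrow> real) \<Rightarrow> (nat \<Rightarrow> real) \<Rightarrow> bool" where
  "admissible P \<phi> \<psi> \<longleftrightarrow> \<phi> \<le> \<psi> \<and> (\<forall>x\<in>P. \<psi> x = \<phi> x) \<and> feasible \<xi> {e \<in> E. fst e \<notin> P} \<psi>"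

text \<open>The reported chain from \<open>u\<close> back to \<open>a\<close>, along which hedging
  would have to raise \<open>a\<close>. The condition on \<open>P\<close> is what allows the next
  pending edge to be put in front without repeating a head.\<close>

definition gaining_walk :: "nat set \<Rightarrow> nat \<Rightarrow> (nat \<Rightarrow> real) \<Rightarrow> (nat \<times> nat) list \<Rightarrow> bool" where
  "gaining_walk P u \<phi> c \<longleftrightarrow> c \<noteq> [] \<and> pcas u c a \<and> set c \<subseteq> E \<and> distinct (map snd c) \<and>
     snd ` set c \<inter> P \<subseteq> {a} \<and> \<phi> a < prod_list (map (case_prod \<xi>) c) * \<phi> u"

text \<open>
  \<open>P\<close> is the set of tails of the pending calls. Along the pending chain the ratio
  \<open>\<phi> / \<phi>\<^sub>0\<close> cannot increase, since \<open>\<phi>\<close> gains exactly the factor \<open>\<xi>\<close> and \<open>\<phi>\<^sub>0\<close> at least that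
  factor. So a pending vertex other than \<open>a\<close> never needs a new handicap, and the recursion
  depth is at most the number of vertices.
\<close>

lemma hedge_call:
  assumes "(u, v) \<in> E" "a \<in> P" "u \<in> P" "P \<subseteq> V" "\<phi>\<^sub>0 \<le> \<phi>" "feasible \<xi> {e \<in> E. fst e \<notin> P} \<phi>"
    and "\<And>x. x \<in> P \<Longrightarrow> x \<noteq> a \<Longrightarrow> \<phi> u * \<phi>\<^sub>0 x \<le> \<phi> x * \<phi>\<^sub>0 u"
    and "u = a \<Longrightarrow> P = {a}"
  shows "\<exists>r. hedge \<xi> succs u v a \<phi> = Some r \<and>
    (case r of Return1 \<psi> \<Rightarrow> admissible P \<phi> \<psi> \<and> \<xi> u v * \<phi> u \<le> \<psi> v | Return0 c \<Rightarrow> gaining_walk P u \<phi> c)"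
  using assms
proof (induction "card (V - P)" arbitrary: P u v \<phi> rule: less_induct)
  case less
  have uV: "u \<in> V" and vV: "v \<in> V" using E_subset less.prems by auto
  have pos: "\<phi> x > 0" if "x \<in> V" for x
    using handicap_pos[OF that] less.prems(5) by (meson le_fun_def less_le_trans)
  consider
    (kept) "\<xi> u v * \<phi> u \<le> \<phi> v" | (closed) "\<not> \<xi> u v * \<phi> u \<le> \<phi> v" "v = a"
    | (new) "\<not> \<xi> u v * \<phi> u \<le> \<phi> v" "v \<noteq> a"
    by blast
  then show ?case
  proof cases
    case kept
    then show ?thesis
      using less.prems by (subst hedge.simps) (simp add: admissible_def)
  next
    case closed
    then show ?thesis
      using less.prems by (subst hedge.simps) (simp add: gaining_walk_def)
  next
    case new
    have feas_uv: "\<xi> u v * \<phi>\<^sub>0 u \<le> \<phi>\<^sub>0 v" if "u \<noteq> a"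
      using feasible_0 less.prems(1) that by (auto simp: feasible_def)
    \<comment> \<open>The outermost call, with \<open>u = a\<close>, has \<open>a\<close> as its
      only pending tail. So a pending \<open>v\<close> other than \<open>a\<close> forces
      \<open>u\<close> to differ from \<open>a\<close>, and then the edge inequality for
      \<open>\<phi>\<^sub>0\<close> holds at \<open>(u, v)\<close>.\<close>
    have "v \<notin> P"
    proof
      assume "v \<in> P"
      then have "u \<noteq> a" using less.prems(8) new by auto
      have "\<xi> u v * \<phi> u * \<phi>\<^sub>0 u = \<phi> u * (\<xi> u v * \<phi>\<^sub>0 u)" by simp
      also have "\<dots> \<le> \<phi> u * \<phi>\<^sub>0 v"
        using feas_uv \<open>u \<noteq> a\<close> pos[OF uV] by (intro mult_left_mono) auto
      also have "\<dots> \<le> \<phi> v * \<phi>\<^sub>0 u"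
        using less.prems(7)[OF \<open>v \<in> P\<close> new(2)] .
      finally show False
        using new(1) handicap_pos[OF uV] by simp
    qed
    define \<phi>' where "\<phi>' = \<phi>(v := \<xi> u v * \<phi> u)"
    have \<phi>'_v: "\<phi>' v = \<xi> u v * \<phi> u" and \<phi>'_P: "x \<in> P \<Longrightarrow> \<phi>' x = \<phi> x" for x
      using \<open>v \<notin> P\<close> by (auto simp: \<phi>'_def)
    have le: "\<phi> \<le> \<phi>'" using new by (auto simp: \<phi>'_def le_fun_def)
    let ?P = "insert v P"
    have smaller: "card (V - ?P) < card (V - P)"
      using finite_V vV \<open>v \<notin> P\<close> by (intro psubset_card_mono) auto
    have ratio: "\<phi>' v * \<phi>\<^sub>0 x \<le> \<phi>' x * \<phi>\<^sub>0 v" if "x \<in> ?P" "x \<noteq> a" for x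
    proof (cases "x = v")
      case False
      then have "x \<in> P" using that by simp
      then have "u \<noteq> a" using less.prems(8) that(2) by auto
      have xV: "x \<in> V" using \<open>x \<in> P\<close> less.prems(4) by auto
      have "\<phi>' v * \<phi>\<^sub>0 x = \<xi> u v * (\<phi> u * \<phi>\<^sub>0 x)" by (simp add: \<phi>'_v)
      also have "\<dots> \<le> \<xi> u v * (\<phi> x * \<phi>\<^sub>0 u)"
        using less.prems(7)[OF \<open>x \<in> P\<close> that(2)] weight_pos[OF less.prems(1)] by simp
      also have "\<dots> = \<phi> x * (\<xi> u v * \<phi>\<^sub>0 u)" by simp
      also have "\<dots> \<le> \<phi> x * \<phi>\<^sub>0 v"
        using feas_uv[OF \<open>u \<noteq> a\<close>] pos[OF xV] by (intro mult_left_mono) auto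
      finally show ?thesis using \<phi>'_P \<open>x \<in> P\<close> by simp
    qed simp
    \<comment> \<open>Raising \<open>v\<close> helps the edges into \<open>v\<close> and can break
      only those leaving \<open>v\<close>, which are exempt once \<open>v\<close> is
      pending.\<close>
    have feas': "feasible \<xi> {e \<in> E. fst e \<notin> ?P} \<phi>'"
      unfolding feasible_def
    proof clarsimp
      fix x y assume "(x, y) \<in> E" "x \<noteq> v" "x \<notin> P"
      then have "\<xi> x y * \<phi> x \<le> \<phi> y" using less.prems(6) by (auto simp: feasible_def)
      also have "\<dots> \<le> \<phi>' y" using le by (simp add: le_fun_def)
      finally show "\<xi> x y * \<phi>' x \<le> \<phi>' y" using \<open>x \<noteq> v\<close> by (simp add: \<phi>'_def)
    qed
    \<comment> \<open>Earlier calls of the loop may have raised handicaps outside the pending tails.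
      The induction hypothesis is therefore applied to the current \<psi> and then restated relative
      to \<open>\<phi>'\<close>, which agrees with \<psi> on those tails.\<close>
    have call: "\<exists>r. hedge \<xi> succs v w a \<psi> = Some r \<and>
      (case r of Return1 \<psi>' \<Rightarrow> admissible ?P \<phi>' \<psi>' \<and> \<xi> v w * \<phi>' v \<le> \<psi>' w \<and>
          (\<forall>w'. \<xi> v w' * \<phi>' v \<le> \<psi> w' \<longrightarrow> \<xi> v w' * \<phi>' v \<le> \<psi>' w')
        | Return0 c \<Rightarrow> gaining_walk ?P v \<phi>' c)"
      if "w \<in> set (succs \<phi>' v)" "admissible ?P \<phi>' \<psi>" for w \<psi>
    proof -
      have eq: "\<psi> x = \<phi>' x" if "x \<in> ?P" for x
        using \<open>admissible ?P \<phi>' \<psi>\<close> that unfolding admissible_def by blast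
      have "\<phi>' \<le> \<psi>" using that by (simp add: admissible_def)
      have "\<phi>\<^sub>0 \<le> \<psi>" using less.prems(5) le \<open>\<phi>' \<le> \<psi>\<close> by (meson order_trans)
      have "\<exists>r. hedge \<xi> succs v w a \<psi> = Some r \<and>
        (case r of Return1 \<psi>' \<Rightarrow> admissible ?P \<psi> \<psi>' \<and> \<xi> v w * \<psi> v \<le> \<psi>' w | Return0 c \<Rightarrow> gaining_walk ?P v \<psi> c)"
      proof (rule less.hyps[OF smaller])
        show "(v, w) \<in> E" using that set_succs by auto
        show "feasible \<xi> {e \<in> E. fst e \<notin> ?P} \<psi>" using that by (simp add: admissible_def)
        show "\<psi> v * \<phi>\<^sub>0 x \<le> \<psi> x * \<phi>\<^sub>0 v" if "x \<in> ?P" "x \<noteq> a" for x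
          using ratio[OF that] eq[OF that(1)] eq[of v] by simp
        show "a \<in> ?P" "v \<in> ?P" "?P \<subseteq> V" using less.prems vV by auto
        show "v = a \<Longrightarrow> ?P = {a}" using new by simp
      qed fact
      then obtain r where r: "hedge \<xi> succs v w a \<psi> = Some r"
        "case r of Return1 \<psi>' \<Rightarrow> admissible ?P \<psi> \<psi>' \<and> \<xi> v w * \<psi> v \<le> \<psi>' w | Return0 c \<Rightarrow> gaining_walk ?P v \<psi> c"
        by blast
      have "\<psi> v = \<phi>' v" "\<psi> a = \<phi>' a" using eq less.prems(2) by auto
      show ?thesis
      proof (cases r)
        case (Return1 \<psi>')
        then have *: "admissible ?P \<psi> \<psi>'" "\<xi> v w * \<phi>' v \<le> \<psi>' w" using r \<open>\<psi> v = \<phi>' v\<close> by auto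
        have "\<psi> \<le> \<psi>'" using * by (simp add: admissible_def)
        moreover have "admissible ?P \<phi>' \<psi>'"
          using * that(2) by (auto simp: admissible_def)
        ultimately show ?thesis
          using r(1) Return1 * by (auto simp: le_fun_def intro: order_trans)
      next
        case (Return0 c)
        then show ?thesis
          using r \<open>\<psi> v = \<phi>' v\<close> \<open>\<psi> a = \<phi>' a\<close> by (auto simp: gaining_walk_def)
      qed
    qed
    have "admissible ?P \<phi>' \<phi>'" using feas' by (simp add: admissible_def)
    from for_each_invariant[where I = "admissible ?P \<phi>'" and ws = "succs \<phi>' v" and h = "\<lambda>w \<psi>. hedge \<xi> succs v w a \<psi>"
        and Q = "\<lambda>w \<psi>. \<xi> v w * \<phi>' v \<le> \<psi> w" and R = "gaining_walk ?P v \<phi>'", OF this call]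
    obtain r where r: "for_each (\<lambda>w \<psi>. hedge \<xi> succs v w a \<psi>) (succs \<phi>' v) \<phi>' = Some r"
      "case r of Return1 \<psi>' \<Rightarrow> admissible ?P \<phi>' \<psi>' \<and> (\<forall>w\<in>set (succs \<phi>' v). \<xi> v w * \<phi>' v \<le> \<psi>' w) \<and>
          (\<forall>w. \<xi> v w * \<phi>' v \<le> \<phi>' w \<longrightarrow> \<xi> v w * \<phi>' v \<le> \<psi>' w)
        | Return0 c \<Rightarrow> gaining_walk ?P v \<phi>' c"
      by blast
    have step: "hedge \<xi> succs u v a \<phi> = (case r of Return1 \<psi> \<Rightarrow> Some (Return1 \<psi>)
        | Return0 c \<Rightarrow> Some (Return0 ((u, v) # c)))"
      unfolding hedge.simps[of \<xi> succs u v a \<phi>] using new r(1) by (simp add: \<phi>'_def Let_def)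
    show ?thesis
    proof (cases r)
      case (Return1 \<psi>)
      then have \<psi>: "admissible ?P \<phi>' \<psi>" "\<And>w. (v, w) \<in> E \<Longrightarrow> \<xi> v w * \<phi>' v \<le> \<psi> w"
        using r set_succs by auto
      have "\<psi> v = \<phi>' v" using \<psi> by (simp add: admissible_def)
      have "feasible \<xi> {e \<in> E. fst e \<notin> P} \<psi>"
        unfolding feasible_def
      proof clarsimp
        fix x y assume "(x, y) \<in> E" "x \<notin> P"
        then show "\<xi> x y * \<psi> x \<le> \<psi> y"
          using \<psi> \<open>\<psi> v = \<phi>' v\<close> by (cases "x = v") (auto simp: admissible_def feasible_def)
      qed
      then have "admissible P \<phi> \<psi>"
        using \<psi>(1) le \<phi>'_P by (auto simp: admissible_def)
      then show ?thesis using step Return1 \<open>\<psi> v = \<phi>' v\<close> \<phi>'_v by simp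
    next
      case (Return0 c)
      then have c: "gaining_walk ?P v \<phi>' c" using r by simp
      \<comment> \<open>As a pending tail other than \<open>a\<close>, \<open>v\<close> is not a
        head of \<open>c\<close>, so \<open>(u, v)\<close> can be put in front. The value chosen for
        \<open>\<phi>' v\<close> turns the gain from \<open>v\<close> into a gain from
        \<open>u\<close>.\<close>
      have "v \<notin> snd ` set c" using c new by (auto simp: gaining_walk_def)
      then have "gaining_walk P u \<phi> ((u, v) # c)"
        using c less.prems \<open>v \<notin> P\<close> \<phi>'_v \<phi>'_P by (auto simp: gaining_walk_def mult_ac)
      then show ?thesis using step Return0 by simp
    qed
  qed
qed

text \<open>For \<open>P = {a}\<close> the ratio hypothesis is vacuous. A gaining walk from
  \<open>a\<close> to \<open>a\<close> has weight product above 1 after division by the positive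
  handicap of \<open>a\<close>.\<close>

lemma hedge_from_root:
  assumes "(a, b) \<in> E"
  shows "\<exists>r. hedge \<xi> succs a b a \<phi>\<^sub>0 = Some r \<and>
    (case r of Return1 \<psi> \<Rightarrow> \<phi>\<^sub>0 \<le> \<psi> \<and> feasible \<xi> {e \<in> E. fst e \<noteq> a} \<psi> \<and> \<psi> a = \<phi>\<^sub>0 a \<and> \<xi> a b * \<psi> a \<le> \<psi> b
      | Return0 c \<Rightarrow> c \<noteq> [] \<and> pcas a c a \<and> set c \<subseteq> E \<and> distinct (map snd c) \<and>
          1 < prod_list (map (case_prod \<xi>) c))"
proof -
  have "a \<in> V" using assms E_subset by auto
  obtain r where r: "hedge \<xi> succs a b a \<phi>\<^sub>0 = Some r"
    "case r of Return1 \<psi> \<Rightarrow> admissible {a} \<phi>\<^sub>0 \<psi> \<and> \<xi> a b * \<phi>\<^sub>0 a \<le> \<psi> b | Return0 c \<Rightarrow> gaining_walk {a} a \<phi>\<^sub>0 c"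
    using hedge_call[of a b "{a}" \<phi>\<^sub>0] assms feasible_0 \<open>a \<in> V\<close> by auto
  then show ?thesis
    using handicap_pos[OF \<open>a \<in> V\<close>]
    by (cases r) (auto simp: admissible_def gaining_walk_def)
qed

end

section \<open>Adding the remaining edges one at a time\<close>

lemma add_edges_cases:
  assumes "finite V" "E \<union> set es \<subseteq> V \<times> V"
    and "\<And>x y. (x, y) \<in> E \<union> set es \<Longrightarrow> \<xi> x y > 0"
    and "\<And>x. x \<in> V \<Longrightarrow> \<phi> x > 0" "feasible \<xi> E \<phi>"
    and "\<And>E' \<phi> v. E' \<subseteq> E \<union> set es \<Longrightarrow> set (ord E' \<phi> v) = E' `` {v}"
  shows "(\<exists>\<psi>. add_edges \<xi> ord E es \<phi> = Some (Return1 \<psi>) \<and> \<phi> \<le> \<psi> \<and> feasible \<xi> (E \<union> set es) \<psi>) \<or>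
    (\<exists>c u. add_edges \<xi> ord E es \<phi> = Some (Return0 c) \<and> c \<noteq> [] \<and> pcas u c u \<and> set c \<subseteq> E \<union> set es \<and>
       distinct (map snd c) \<and> 1 < prod_list (map (case_prod \<xi>) c))"
  using assms
proof (induction es arbitrary: E \<phi>)
  case Nil
  then show ?case by simp
next
  case (Cons e es)
  obtain a b where e: "e = (a, b)" by fastforce
  let ?E = "insert (a, b) E"
  have E: "?E \<union> set es = E \<union> set (e # es)" by (auto simp: e)
  interpret hedging \<xi> V ?E a \<phi> "ord ?E"
  proof
    show "finite V" by fact
    show "?E \<subseteq> V \<times> V" using Cons.prems(2) e by auto
    show "\<xi> x y > 0" if "(x, y) \<in> ?E" for x y using Cons.prems(3) e that by auto
    show "\<phi> x > 0" if "x \<in> V" for x using Cons.prems(4) that by auto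
    show "feasible \<xi> {e \<in> ?E. fst e \<noteq> a} \<phi>" using Cons.prems(5) by (auto simp: feasible_def)
    show "set (ord ?E \<phi> v) = ?E `` {v}" for \<phi> v by (rule Cons.prems(6)) (auto simp: e)
  qed
  obtain r where r: "hedge \<xi> (ord ?E) a b a \<phi> = Some r"
    "case r of Return1 \<psi> \<Rightarrow> \<phi> \<le> \<psi> \<and> feasible \<xi> {e \<in> ?E. fst e \<noteq> a} \<psi> \<and> \<psi> a = \<phi> a \<and> \<xi> a b * \<psi> a \<le> \<psi> b
      | Return0 c \<Rightarrow> c \<noteq> [] \<and> pcas a c a \<and> set c \<subseteq> ?E \<and> distinct (map snd c) \<and>
          1 < prod_list (map (case_prod \<xi>) c)"
    using hedge_from_root[of b] by auto
  show ?case
  proof (cases r)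
    case (Return1 \<psi>)
    then have \<psi>: "\<phi> \<le> \<psi>" "feasible \<xi> {e \<in> ?E. fst e \<noteq> a} \<psi>" "\<psi> a = \<phi> a" "\<xi> a b * \<psi> a \<le> \<psi> b"
      using r by auto
    \<comment> \<open>The old edges leaving \<open>a\<close> are not covered by hedging. They held
      before the call, the handicap of \<open>a\<close> is unchanged, and the handicaps of their
      heads can only have grown.\<close>
    have "feasible \<xi> ?E \<psi>"
      unfolding feasible_def
    proof clarify
      fix x y assume xy: "(x, y) \<in> ?E"
      show "\<xi> x y * \<psi> x \<le> \<psi> y"
      proof (cases "x \<noteq> a \<or> (x, y) = (a, b)")
        case True
        then show ?thesis using \<psi> xy by (cases "x = a") (auto simp: feasible_def)
      next
        case False
        then have "\<xi> x y * \<psi> x \<le> \<phi> y" using xy Cons.prems(5) \<psi>(3) by (auto simp: feasible_def)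
        also have "\<dots> \<le> \<psi> y" using \<psi>(1) by (simp add: le_fun_def)
        finally show ?thesis .
      qed
    qed
    moreover have "\<psi> x > 0" if "x \<in> V" for x
      using Cons.prems(4)[OF that] \<psi>(1) by (meson le_fun_def less_le_trans)
    ultimately have "(\<exists>\<psi>'. add_edges \<xi> ord ?E es \<psi> = Some (Return1 \<psi>') \<and> \<psi> \<le> \<psi>' \<and> feasible \<xi> (?E \<union> set es) \<psi>') \<or>
      (\<exists>c u. add_edges \<xi> ord ?E es \<psi> = Some (Return0 c) \<and> c \<noteq> [] \<and> pcas u c u \<and> set c \<subseteq> ?E \<union> set es \<and>
       distinct (map snd c) \<and> 1 < prod_list (map (case_prod \<xi>) c))"
      using Cons.prems unfolding E[symmetric] by (intro Cons.IH) auto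
    moreover have "add_edges \<xi> ord E (e # es) \<phi> = add_edges \<xi> ord ?E es \<psi>"
      using r(1) Return1 by (simp add: e Let_def)
    ultimately show ?thesis
      unfolding E using order_trans[OF \<psi>(1)] by auto
  next
    case (Return0 c)
    then show ?thesis using r by (auto simp: e Let_def)
  qed
qed


section \<open>Walks, cycles and paths as edge lists\<close>

lemma pcas_append: "pcas u (p @ q) v \<longleftrightarrow> (\<exists>w. pcas u p w \<and> pcas w q v)"
  by (induction p arbitrary: u) auto

lemma pcas_end_in_heads: "pcas u p v \<Longrightarrow> p \<noteq> [] \<Longrightarrow> v \<in> snd ` set p"
  by (induction p arbitrary: u) (auto, metis pcas.simps(1))

lemma pawalk_verts_eq: "pcas u p v \<Longrightarrow> pawalk_verts u p = u # map snd p"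
  by (induction p arbitrary: u) auto

lemma pcas_leaves_set:
  "pcas u p v \<Longrightarrow> u \<in> W \<Longrightarrow> v \<notin> W \<Longrightarrow> \<exists>(x, y)\<in>set p. x \<in> W \<and> y \<notin> W"
proof (induction p arbitrary: u)
  case (Cons e p)
  then show ?case by (cases "snd e \<in> W") (auto simp: case_prod_beta)
qed simp

text \<open>The vertices visited after the start are the heads of the edges, so simplicity becomes
  distinctness of \<open>map snd p\<close>.\<close>

lemma cycle_with_proj_iff:
  "pre_digraph.cycle (with_proj G) p \<longleftrightarrow>
     (\<exists>u\<in>pverts G. set p \<subseteq> parcs G \<and> pcas u p u \<and> distinct (map snd p) \<and> p \<noteq> [])"
  using pawalk_verts_eq
  by (fastforce simp: pre_digraph.cycle_def pre_digraph.awalk_def cas_with_proj_eq awalk_verts_with_proj_eq)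

lemma apath_with_proj_iff:
  "pre_digraph.apath (with_proj G) u p v \<longleftrightarrow>
     u \<in> pverts G \<and> set p \<subseteq> parcs G \<and> pcas u p v \<and> distinct (u # map snd p)"
  using pawalk_verts_eq[of u p v]
  by (auto simp: pre_digraph.apath_def pre_digraph.awalk_def cas_with_proj_eq awalk_verts_with_proj_eq)
    (metis image_eqI snd_conv)+

text \<open>The edge inequalities telescope, as nonnegative weights preserve them. On a closed walk
  through a vertex of positive handicap this bounds the weight product by 1.\<close>

lemma feasible_walk:
  assumes "pcas u p v" "feasible \<xi> (set p) \<phi>" "\<And>x y. (x, y) \<in> set p \<Longrightarrow> \<xi> x y \<ge> 0"
  shows "prod_list (map (case_prod \<xi>) p) * \<phi> u \<le> \<phi> v"
  using assms
proof (induction p arbitrary: u)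
  case (Cons e p)
  obtain w where e: "e = (u, w)" and p: "pcas w p v" using Cons.prems(1) by (cases e) auto
  let ?c = "prod_list (map (case_prod \<xi>) p)"
  have "?c \<ge> 0"
    using Cons.prems(3) by (intro prod_list_nonneg) auto
  moreover have "\<xi> u w * \<phi> u \<le> \<phi> w" using Cons.prems(2) by (simp add: e feasible_def)
  ultimately have "?c * (\<xi> u w * \<phi> u) \<le> ?c * \<phi> w" by (rule mult_left_mono[rotated])
  also have "\<dots> \<le> \<phi> v"
    using p Cons.prems by (intro Cons.IH) (auto simp: feasible_def)
  finally show ?case by (simp add: e mult_ac)
qed simp

section \<open>Outward edge lists and the initial handicaps\<close>

lemma outward_snoc:
  "outward v0 (ts @ [e]) \<longleftrightarrow> outward v0 ts \<and> fst e \<in> insert v0 (snd ` set ts)"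
  by (auto simp: outward_def nth_append less_Suc_eq)

lemma outward_tails: "outward v0 ts \<Longrightarrow> fst ` set ts \<subseteq> insert v0 (snd ` set ts)"
  by (induction ts rule: rev_induct) (auto simp: outward_snoc)

text \<open>The head of each new edge is fresh: it is neither head nor tail of an earlier edge. It
  can thus be ranked one above its parent without disturbing earlier ranks. The rank rules out
  cycles and supports induction from the root.\<close>

lemma outward_rank:
  assumes "outward v0 ts" "distinct (v0 # map snd ts)"
  shows "\<exists>r :: nat \<Rightarrow> nat. \<forall>(x, y)\<in>set ts. r x < r y"
  using assms
proof (induction ts rule: rev_induct)
  case (snoc e ts)
  obtain u w where e: "e = (u, w)" by fastforce
  obtain r :: "nat \<Rightarrow> nat" where r: "\<forall>(x, y)\<in>set ts. r x < r y"
    using snoc by (auto simp: outward_snoc)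
  have w: "w \<notin> insert v0 (snd ` set ts)" and u: "u \<in> insert v0 (snd ` set ts)"
    using snoc.prems by (auto simp: e outward_snoc)
  have w': "w \<notin> fst ` set ts" using w outward_tails snoc.prems(1) by (auto simp: outward_snoc)
  have "\<forall>(x, y)\<in>set (ts @ [e]). (r(w := Suc (r u))) x < (r(w := Suc (r u))) y"
  proof clarify
    fix x y assume xy: "(x, y) \<in> set (ts @ [e])"
    show "(r(w := Suc (r u))) x < (r(w := Suc (r u))) y"
    proof (cases "(x, y) \<in> set ts")
      case True
      then have "x \<noteq> w" "y \<noteq> w" using w w' by force+
      then show ?thesis using r True by auto
    next
      case False
      then show ?thesis using xy u w by (auto simp: e)
    qed
  qed
  then show ?case by blast
qed simp

text \<open>By the same freshness, each assignment leaves the endpoints of all earlier edges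
  untouched, so every tree edge keeps the equality with which it was processed.\<close>

lemma init_handicaps_outward:
  assumes "outward v0 ts" "distinct (v0 # map snd ts)" "\<And>x y. (x, y) \<in> set ts \<Longrightarrow> \<xi> x y > 0"
  shows "(\<forall>x\<in>insert v0 (snd ` set ts). init_handicaps \<xi> v0 ts x > 0) \<and> feasible \<xi> (set ts) (init_handicaps \<xi> v0 ts)"
  using assms
proof (induction ts rule: rev_induct)
  case Nil
  then show ?case by (simp add: init_handicaps_def feasible_def)
next
  case (snoc e ts)
  obtain u w where e: "e = (u, w)" by fastforce
  let ?\<phi> = "init_handicaps \<xi> v0 ts"
  have IH: "\<forall>x\<in>insert v0 (snd ` set ts). ?\<phi> x > 0" "feasible \<xi> (set ts) ?\<phi>"
    using snoc by (auto simp: outward_snoc)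
  have w: "w \<notin> insert v0 (snd ` set ts)" and u: "u \<in> insert v0 (snd ` set ts)"
    using snoc.prems by (auto simp: e outward_snoc)
  have w': "w \<notin> fst ` set ts" using w outward_tails snoc.prems(1) by (auto simp: outward_snoc)
  have \<phi>: "init_handicaps \<xi> v0 (ts @ [e]) = ?\<phi>(w := \<xi> u w * ?\<phi> u)"
    by (simp add: init_handicaps_def e)
  have "?\<phi> u > 0" using IH(1) u by blast
  then have "\<xi> u w * ?\<phi> u > 0" using snoc.prems(3)[of u w] by (simp add: e)
  moreover have "feasible \<xi> (set (ts @ [e])) (?\<phi>(w := \<xi> u w * ?\<phi> u))"
    unfolding feasible_def
  proof clarify
    fix x y assume xy: "(x, y) \<in> set (ts @ [e])"
    show "\<xi> x y * (?\<phi>(w := \<xi> u w * ?\<phi> u)) x \<le> (?\<phi>(w := \<xi> u w * ?\<phi> u)) y"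
    proof (cases "(x, y) \<in> set ts")
      case True
      then have "x \<noteq> w" "y \<noteq> w" using w w' by force+
      then show ?thesis using feasibleD[OF IH(2) True] by simp
    next
      case False
      then show ?thesis using xy u w by (auto simp: e)
    qed
  qed
  ultimately show ?case
    unfolding \<phi> using IH(1) by (auto simp: e simp del: fun_upd_apply) auto
qed

section \<open>Spanning arborescences and outward edge lists\<close>

text \<open>At a vertex of maximal rank both neighbours on the cycle would be the unique parent.\<close>

lemma no_undirected_cycle:
  fixes r :: "nat \<Rightarrow> nat"
  assumes rank: "\<And>x y. (x, y) \<in> A \<Longrightarrow> r x < r y" and parent: "inj_on snd A"
    and p: "pcas u p u" "set p \<subseteq> A \<union> A\<inverse>" "distinct (map snd p)" "length p \<ge> 3"
  shows False
proof -
  have "r ` snd ` set p \<noteq> {}" using p(4) by auto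
  then have "Max (r ` snd ` set p) \<in> r ` snd ` set p" by (intro Max_in) auto
  then obtain e where e: "e \<in> set p" "r (snd e) = Max (r ` snd ` set p)" by auto
  have max: "r y \<le> r (snd e)" if "y \<in> snd ` set p" for y
    unfolding e(2) using that by auto
  obtain p1 p2 where p12: "p = p1 @ e # p2" using e(1) by (meson split_list)
  \<comment> \<open>Rotate the cycle so that it starts with the edge into the vertex of maximal
    rank.\<close>
  define s where "s = p2 @ p1"
  define q where "q = e # s"
  have q: "pcas (fst e) q (fst e)" "set q = set p" "distinct (map snd q)" "length q \<ge> 3"
    using p by (auto simp: q_def s_def p12 pcas_append)
  obtain y x where ee: "e = (y, x)" by fastforce
  obtain e2 q' where q': "q = e # e2 # q'" "q' \<noteq> []"
    using q(4) unfolding q_def by (cases s; cases "tl s") auto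
  obtain z where e2: "e2 = (x, z)" and w: "pcas z q' y"
    using q(1) by (cases e2) (auto simp: q' ee)
  have y: "y \<in> snd ` set q'" using pcas_end_in_heads[OF w q'(2)] .
  have "snd ` set p = {x, z} \<union> snd ` set q'" unfolding q(2)[symmetric] by (auto simp: q' ee e2)
  then have "r y \<le> r x" "r z \<le> r x"
    using max[of y] max[of z] y by (simp_all add: ee)
  moreover have "(y, x) \<in> A \<union> A\<inverse>" "(x, z) \<in> A \<union> A\<inverse>"
    using p(2) q(2) by (auto simp: q' ee e2)
  ultimately have "(y, x) \<in> A" "(z, x) \<in> A"
    using rank by (auto simp: not_less[symmetric])
  \<comment> \<open>Length at least 3 makes \<open>q'\<close> nonempty, so \<open>y\<close> is a
    head in \<open>q'\<close> while \<open>z\<close> is the head of \<open>e2\<close>; distinct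
    heads forbid that they coincide.\<close>
  then have "y = z" using inj_onD[OF parent, of "(y, x)" "(z, x)"] by simp
  then show False using y q(3) by (auto simp: q' e2)
qed

text \<open>The end vertex determines the last edge, which can be peeled off both walks. No edge
  enters the root, so both walks become empty together.\<close>

lemma walk_from_root_unique:
  assumes "inj_on snd A" "v0 \<notin> snd ` A"
    and "pcas v0 p w" "set p \<subseteq> A" "pcas v0 q w" "set q \<subseteq> A"
  shows "p = q"
  using assms(3-)
proof (induction p arbitrary: q w rule: rev_induct)
  case Nil
  then show ?case using assms(2) pcas_end_in_heads[of v0 q w] by auto
next
  case (snoc e p)
  then have w: "snd e = w" "e \<in> A" "pcas v0 p (fst e)" by (auto simp: pcas_append)
  then have "q \<noteq> []" using snoc.prems(3) assms(2) by auto
  then obtain q' e' where q: "q = q' @ [e']" by (cases q rule: rev_cases) auto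
  then have w': "snd e' = w" "e' \<in> A" "pcas v0 q' (fst e')" using snoc.prems by (auto simp: pcas_append)
  then have "e' = e" using w assms(1) by (auto simp: inj_on_def)
  then show ?case using snoc.IH[of "fst e" q'] w w' snoc.prems q by auto
qed

text \<open>Induction on the rank gives a walk from the root to every vertex. The rank excludes
  antiparallel arcs and, with unique parents, undirected cycles; unique parents also make the paths
  unique.\<close>

lemma spanning_arborescenceI:
  assumes "pair_wf_digraph \<Gamma>" "set ts \<subseteq> parcs \<Gamma>" "outward v0 ts" "distinct (v0 # map snd ts)"
    and V: "insert v0 (snd ` set ts) = pverts \<Gamma>"
  shows "spanning_arborescence \<Gamma> v0 \<lparr>pverts = pverts \<Gamma>, parcs = set ts\<rparr>"
proof -
  let ?T = "\<lparr>pverts = pverts \<Gamma>, parcs = set ts\<rparr>"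
  let ?S = "mk_symmetric (with_proj ?T)"
  interpret \<Gamma>: pair_wf_digraph \<Gamma> by fact
  have "fst e \<in> pverts \<Gamma>" "snd e \<in> pverts \<Gamma>" if "e \<in> set ts" for e
    using that assms(2) \<Gamma>.arc_fst_in_verts \<Gamma>.arc_snd_in_verts by blast+
  then interpret T: pair_wf_digraph ?T by unfold_locales simp_all
  have parcs_S: "parcs ?S = set ts \<union> (set ts)\<inverse>" and pverts_S: "pverts ?S = pverts \<Gamma>"
    by (auto simp: mk_symmetric_def)
  interpret S: pair_sym_digraph ?S
    using T.arc_fst_in_verts T.arc_snd_in_verts
    by unfold_locales (auto simp: parcs_S pverts_S symmetric_def sym_def)
  obtain r :: "nat \<Rightarrow> nat" where r: "\<And>x y. (x, y) \<in> set ts \<Longrightarrow> r x < r y"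
    using outward_rank[OF assms(3,4)] by blast
  have inj: "inj_on snd (set ts)" using assms(4) by (simp add: distinct_map)
  have root: "v0 \<notin> snd ` set ts" using assms(4) by simp
  have "v0 \<in> pverts \<Gamma>" using V by auto
  have reach: "v0 \<rightarrow>\<^sup>*\<^bsub>with_proj ?T\<^esub> w" if "w \<in> pverts \<Gamma>" for w
    using that
  proof (induction "r w" arbitrary: w rule: less_induct)
    case less
    show ?case
    proof (cases "w = v0")
      case True
      then show ?thesis using \<open>v0 \<in> pverts \<Gamma>\<close> by (simp add: T.reachable_refl)
    next
      case False
      then obtain u where u: "(u, w) \<in> set ts" using less.prems V by auto
      then have "v0 \<rightarrow>\<^sup>*\<^bsub>with_proj ?T\<^esub> u" using r T.in_arcsD1[of u w] by (intro less.hyps) auto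
      then show ?thesis using u T.reachable_adj_trans by simp
    qed
  qed
  have "v0 \<rightarrow>\<^sup>*\<^bsub>with_proj ?S\<^esub> w" if "w \<in> pverts \<Gamma>" for w
    using reach[OF that] by (rule T.reachable_mk_symmetricI)
  then have "strongly_connected (with_proj ?S)"
    unfolding strongly_connected_def with_proj_simps pverts_S
    using \<open>v0 \<in> pverts \<Gamma>\<close> S.symmetric_reachable' S.reachable_trans by blast
  then have "Digraph_Component.connected (with_proj ?T)" by (simp add: Digraph_Component.connected_def)
  moreover have "asym (parcs ?T)"
    using r by (intro asymI) (auto, meson less_asym)
  moreover have "\<not> (\<exists>p. pre_digraph.cycle (with_proj ?S) p \<and> length p \<ge> 3)"
    using no_undirected_cycle[of "set ts" r, OF r inj] unfolding cycle_with_proj_iff parcs_S by blast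
  moreover have "\<exists>!p. pre_digraph.apath (with_proj ?T) v0 p w" if "w \<in> pverts \<Gamma>" for w
  proof (rule ex_ex1I)
    show "\<exists>p. pre_digraph.apath (with_proj ?T) v0 p w" using reach[OF that] T.reachable_apath by auto
    show "p = q" if "pre_digraph.apath (with_proj ?T) v0 p w" "pre_digraph.apath (with_proj ?T) v0 q w" for p q
      using that by (intro walk_from_root_unique[OF inj root, of p w q]) (simp_all add: apath_with_proj_iff)
  qed
  moreover have "spanning (with_proj ?T) (with_proj \<Gamma>)"
    using assms(2) \<Gamma>.wf_digraph T.wf_digraph by (auto simp: spanning_def subgraph_def compatible_def)
  ultimately show ?thesis
    using \<open>v0 \<in> pverts \<Gamma>\<close> by (auto simp: spanning_arborescence_def undirected_tree_def)
qed

text \<open>What initialisation needs from an arbitrary chosen arborescence: each vertex other than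
  the root is the head of exactly one listed edge, hence receives its handicap exactly once.\<close>

lemma spanning_arborescenceD:
  assumes sp: "spanning_arborescence \<Gamma> v0 \<lparr>pverts = pverts \<Gamma>, parcs = set ts\<rparr>" and "distinct ts"
  shows "distinct (v0 # map snd ts)" "insert v0 (snd ` set ts) = pverts \<Gamma>"
proof -
  let ?T = "\<lparr>pverts = pverts \<Gamma>, parcs = set ts\<rparr>"
  have wf: "wf_digraph (with_proj ?T)" and "v0 \<in> pverts \<Gamma>" and asym: "asym (set ts)"
    and acyc: "\<not> (\<exists>p. pre_digraph.cycle (with_proj (mk_symmetric (with_proj ?T))) p \<and> length p \<ge> 3)"
    and paths: "\<And>w. w \<in> pverts \<Gamma> \<Longrightarrow> w \<noteq> v0 \<Longrightarrow> \<exists>!p. pre_digraph.apath (with_proj ?T) v0 p w"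
    using sp by (auto simp: spanning_arborescence_def spanning_def subgraph_def undirected_tree_def)
  interpret T: pair_wf_digraph ?T using wf by (simp add: wf_digraph_wp_iff)
  \<comment> \<open>A closed walk contains a directed cycle, which is also a cycle of the symmetric
    digraph and so has length 1 or 2. Asymmetry excludes loops and antiparallel pairs.\<close>
  have no_closed_walk: False if "pcas u p u" "set p \<subseteq> set ts" "p \<noteq> []" for u p
  proof -
    have "u \<in> pverts \<Gamma>"
      using pcas_end_in_heads[OF that(1,3)] that(2) T.arc_snd_in_verts by auto
    then have "T.closed_w p" using that by (auto simp: T.closed_w_def T.awalk_def)
    then obtain c where "pre_digraph.cycle (with_proj ?T) c" using T.closed_w_imp_cycle by blast
    then obtain v where v: "v \<in> pverts \<Gamma>" "set c \<subseteq> set ts" "pcas v c v" "distinct (map snd c)" "c \<noteq> []"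
      by (auto simp: cycle_with_proj_iff)
    then have "pre_digraph.cycle (with_proj (mk_symmetric (with_proj ?T))) c"
      unfolding cycle_with_proj_iff by (fastforce simp: mk_symmetric_def)
    then have "length c < 3" using acyc by auto
    then consider "length c = 1" | "length c = 2" using v(5) by (cases c) (auto simp: less_Suc_eq numeral_3_eq_3)
    then show False
    proof cases
      case 1
      then obtain e where "c = [e]" by (auto simp: length_Suc_conv)
      then have "(v, v) \<in> set ts" using v by (cases e) auto
      then show False using asym by (auto dest: asymD)
    next
      case 2
      then obtain e e' where "c = [e, e']" by (auto simp: length_Suc_conv numeral_2_eq_2)
      then have "(v, fst e') \<in> set ts" "(fst e', v) \<in> set ts" using v by (cases e; cases e'; auto)+
      then show False using asym by (auto dest: asymD)
    qed
  qed
  have path: "\<exists>p. set p \<subseteq> set ts \<and> pcas v0 p w \<and> distinct (v0 # map snd p)" if "w \<in> pverts \<Gamma>" for w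
  proof (cases "w = v0")
    case True
    then show ?thesis by (intro exI[of _ "[]"]) auto
  next
    case False
    then show ?thesis using paths[OF that False] by (auto simp: apath_with_proj_iff)
  qed
  show "insert v0 (snd ` set ts) = pverts \<Gamma>"
  proof
    show "insert v0 (snd ` set ts) \<subseteq> pverts \<Gamma>"
      using \<open>v0 \<in> pverts \<Gamma>\<close> T.arc_snd_in_verts by auto
    show "pverts \<Gamma> \<subseteq> insert v0 (snd ` set ts)"
    proof
      fix w assume "w \<in> pverts \<Gamma>"
      then obtain p where p: "set p \<subseteq> set ts" "pcas v0 p w" using path by blast
      then show "w \<in> insert v0 (snd ` set ts)"
        using pcas_end_in_heads[OF p(2)] by (cases "p = []") auto
    qed
  qed
  have root: "v0 \<notin> snd ` set ts"
  proof
    assume "v0 \<in> snd ` set ts"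
    then obtain u where u: "(u, v0) \<in> set ts" by auto
    then have "u \<in> pverts \<Gamma>" using T.in_arcsD1[of u v0] by simp
    then obtain p where "set p \<subseteq> set ts" "pcas v0 p u" using path by blast
    then show False using no_closed_walk[of v0 "p @ [(u, v0)]"] u by (auto simp: pcas_append simp del: T.cas_append_iff)
  qed
  \<comment> \<open>Appending \<open>(u, w)\<close> to a simple path from the root to
    \<open>u\<close> keeps it simple, since a return to \<open>w\<close> would close a walk. Two
    edges into \<open>w\<close> would thus give two simple paths to \<open>w\<close>.\<close>
  have extend: "\<exists>p. pre_digraph.apath (with_proj ?T) v0 (p @ [(u, w)]) w" if uw: "(u, w) \<in> set ts" for u w
  proof -
    have "u \<in> pverts \<Gamma>" using uw T.in_arcsD1[of u w] by simp
    then obtain p where p: "set p \<subseteq> set ts" "pcas v0 p u" "distinct (v0 # map snd p)" using path by blast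
    have "w \<notin> snd ` set p"
    proof
      assume "w \<in> snd ` set p"
      then obtain x p1 p2 where "p = p1 @ (x, w) # p2" by (auto dest: split_list)
      then show False
        using no_closed_walk[of w "p2 @ [(u, w)]"] uw p by (auto simp: pcas_append simp del: T.cas_append_iff)
    qed
    moreover have "w \<noteq> v0" using root uw by force
    ultimately show ?thesis
      using p uw \<open>v0 \<in> pverts \<Gamma>\<close> by (auto simp: apath_with_proj_iff pcas_append simp del: T.cas_append_iff)
  qed
  have "inj_on snd (set ts)"
  proof (rule inj_onI)
    fix e e' assume ee: "e \<in> set ts" "e' \<in> set ts" "snd e = snd e'"
    obtain u w u' where e: "e = (u, w)" "e' = (u', w)" using ee(3) by (cases e; cases e') auto
    have "w \<in> pverts \<Gamma>" "w \<noteq> v0" using ee e T.in_arcsD2[of u w] root by force+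
    moreover obtain p p' where "pre_digraph.apath (with_proj ?T) v0 (p @ [(u, w)]) w"
      "pre_digraph.apath (with_proj ?T) v0 (p' @ [(u', w)]) w"
      using extend ee e by blast
    ultimately have "p @ [(u, w)] = p' @ [(u', w)]" using paths by blast
    then show "e = e'" by (simp add: e)
  qed
  then show "distinct (v0 # map snd ts)" using root \<open>distinct ts\<close> by (simp add: distinct_map)
qed

text \<open>Take a longest outward list with distinct heads; its length is bounded by the number of
  arcs. If it missed a vertex, a walk from the root to that vertex would contain an arc leaving the
  covered set, and this arc would extend the list.\<close>

lemma hha_choices_exist:
  assumes "pair_wf_digraph \<Gamma>" "finite (pverts \<Gamma>)" "strongly_connected (with_proj \<Gamma>)" "v0 \<in> pverts \<Gamma>"
  shows "\<exists>ts es ord. hha_choices \<Gamma> v0 ts es ord"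
proof -
  interpret pair_wf_digraph \<Gamma> by fact
  have fin: "finite (parcs \<Gamma>)"
  proof (rule finite_subset)
    show "parcs \<Gamma> \<subseteq> pverts \<Gamma> \<times> pverts \<Gamma>" using in_arcsD1 in_arcsD2 by auto
  qed (use assms(2) in simp)
  define P where "P ts \<longleftrightarrow> set ts \<subseteq> parcs \<Gamma> \<and> outward v0 ts \<and> distinct (v0 # map snd ts)" for ts
  have "P []" by (simp add: P_def outward_def)
  moreover have "\<forall>ts. P ts \<longrightarrow> length ts < Suc (card (parcs \<Gamma>))"
  proof (intro allI impI)
    fix ts assume "P ts"
    then have "distinct ts" "set ts \<subseteq> parcs \<Gamma>" by (auto simp: P_def distinct_map)
    then show "length ts < Suc (card (parcs \<Gamma>))"
      using card_mono[OF fin] distinct_card by (metis less_Suc_eq_le)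
  qed
  ultimately obtain ts where ts: "P ts" and max: "\<And>ts'. P ts' \<Longrightarrow> length ts' \<le> length ts"
    using ex_has_greatest_nat[of P "[]" length] by blast
  let ?W = "insert v0 (snd ` set ts)"
  have V: "?W = pverts \<Gamma>"
  proof (rule ccontr)
    assume "?W \<noteq> pverts \<Gamma>"
    moreover have "snd ` set ts \<subseteq> pverts \<Gamma>" using ts arc_snd_in_verts unfolding P_def by blast
    ultimately obtain w where w: "w \<in> pverts \<Gamma>" "w \<notin> ?W" using assms(4) by blast
    then obtain p where "awalk v0 p w"
      using assms(3,4) unfolding strongly_connected_def reachable_awalk with_proj_simps by blast
    then have "set p \<subseteq> parcs \<Gamma>" "pcas v0 p w" by (auto simp: awalk_def)
    then obtain x y where xy: "(x, y) \<in> parcs \<Gamma>" "x \<in> ?W" "y \<notin> ?W"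
      using pcas_leaves_set[of v0 p w ?W] w by blast
    then have "P (ts @ [(x, y)])" using ts by (auto simp: P_def outward_snoc)
    then show False using max by fastforce
  qed
  have "spanning_arborescence \<Gamma> v0 \<lparr>pverts = pverts \<Gamma>, parcs = set ts\<rparr>" "distinct ts" "outward v0 ts"
    using ts V assms(1) by (auto simp: P_def distinct_map intro!: spanning_arborescenceI)
  moreover obtain es where "set es = parcs \<Gamma> - set ts" "distinct es"
    using fin finite_distinct_list[of "parcs \<Gamma> - set ts"] by auto
  moreover define ord where
    "ord E (\<phi> :: nat \<Rightarrow> real) v = (SOME vs. distinct vs \<and> set vs = E `` {v})" for E :: "(nat \<times> nat) set" and \<phi> and v :: nat
  have "distinct (ord E \<phi> v) \<and> set (ord E \<phi> v) = E `` {v}" if "E \<subseteq> parcs \<Gamma>" for E \<phi> v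
  proof -
    have "finite (E `` {v})" using that fin by (meson finite_Image finite_subset)
    then show ?thesis
      unfolding ord_def using finite_distinct_list by (intro someI_ex[where P = "\<lambda>vs. distinct vs \<and> set vs = E `` {v}"]) blast
  qed
  ultimately show ?thesis unfolding hha_choices_def by blast
qed

section \<open>Multipliers and box expansion\<close>

text \<open>A \<open>LEAST\<close> over the reals is meaningful only if the minimum is attained;
  here continuity of the derivative on a nonempty compact box ensures it.\<close>

lemma multiplier_attained:
  assumes "closed_box S"
  obtains z where "z \<in> S" "multiplier (poly p) S = cmod (poly (pderiv p) z)"
    "\<And>y. y \<in> S \<Longrightarrow> multiplier (poly p) S \<le> cmod (poly (pderiv p) y)"
proof -
  obtain a b where ab: "Re a \<le> Re b" "Im a \<le> Im b" "S = cbox a b" using assms by (auto simp: closed_box_def)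
  then have "a \<in> S" by (simp add: in_cbox_complex_iff)
  have "\<exists>z\<in>S. \<forall>y\<in>S. cmod (poly (pderiv p) z) \<le> cmod (poly (pderiv p) y)"
    using ab(3) \<open>a \<in> S\<close> by (intro continuous_attains_inf) (auto intro!: continuous_intros)
  then obtain z where z: "z \<in> S" "\<And>y. y \<in> S \<Longrightarrow> cmod (poly (pderiv p) z) \<le> cmod (poly (pderiv p) y)" by blast
  have "deriv (poly p) y = poly (pderiv p) y" for y by (intro DERIV_imp_deriv poly_DERIV)
  then have "multiplier (poly p) S = cmod (poly (pderiv p) z)"
    unfolding multiplier_def using z by (intro Least_equality) auto
  then show thesis using z that by simp
qed

lemma frechet_derivative_poly: "frechet_derivative (poly p) (at z) v = poly (pderiv p) z * v"
  for p :: "complex poly"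
proof -
  have "(poly p has_derivative (*) (poly (pderiv p) z)) (at z)"
    using poly_DERIV[of p z] by (simp add: has_field_derivative_def)
  then show ?thesis by (simp add: frechet_derivative_at[symmetric])
qed

text \<open>The derivative acts by complex multiplication, so all vectors are stretched equally.
  Testing the vector 1 at a point attaining the multiplier gives one direction; minimality of the
  multiplier and positivity of \<open>\<phi> j\<close> give the other.\<close>

lemma box_expansive_iff_feasible:
  assumes "\<And>k j. (k, j) \<in> E \<Longrightarrow> closed_box (B k) \<and> multiplier (poly p) (B k) > 0 \<and> \<phi> j > 0"
  shows "box_expansive (poly p) B E L \<phi> \<longleftrightarrow> feasible (\<lambda>k j. L / multiplier (poly p) (B k)) E \<phi>"
proof -
  have "(\<forall>z\<in>B k. \<forall>v. L * box_norm \<phi> k v \<le> box_norm \<phi> j (frechet_derivative (poly p) (at z) v)) \<longleftrightarrow>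
      L / multiplier (poly p) (B k) * \<phi> k \<le> \<phi> j" if "(k, j) \<in> E" for k j
  proof -
    let ?m = "multiplier (poly p) (B k)"
    have box: "closed_box (B k)" and pos: "?m > 0" "\<phi> j > 0" using assms[OF that] by auto
    obtain z where z: "z \<in> B k" "?m = cmod (poly (pderiv p) z)"
      "\<And>y. y \<in> B k \<Longrightarrow> ?m \<le> cmod (poly (pderiv p) y)"
      using multiplier_attained[OF box] by metis
    have "(\<forall>z\<in>B k. \<forall>v. L * box_norm \<phi> k v \<le> box_norm \<phi> j (frechet_derivative (poly p) (at z) v)) \<longleftrightarrow>
      L * \<phi> k \<le> \<phi> j * ?m"
    proof
      assume "\<forall>z\<in>B k. \<forall>v. L * box_norm \<phi> k v \<le> box_norm \<phi> j (frechet_derivative (poly p) (at z) v)"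
      then have "L * box_norm \<phi> k 1 \<le> box_norm \<phi> j (frechet_derivative (poly p) (at z) 1)" using z(1) by blast
      then show "L * \<phi> k \<le> \<phi> j * ?m" by (simp add: box_norm_def frechet_derivative_poly z(2))
    next
      assume *: "L * \<phi> k \<le> \<phi> j * ?m"
      show "\<forall>z\<in>B k. \<forall>v. L * box_norm \<phi> k v \<le> box_norm \<phi> j (frechet_derivative (poly p) (at z) v)"
      proof (intro ballI allI)
        fix y v assume "y \<in> B k"
        have "L * \<phi> k \<le> \<phi> j * cmod (poly (pderiv p) y)"
          using * z(3)[OF \<open>y \<in> B k\<close>] pos(2) by (meson mult_left_mono less_imp_le order_trans)
        from mult_right_mono[OF this norm_ge_zero[of v]]
        show "L * box_norm \<phi> k v \<le> box_norm \<phi> j (frechet_derivative (poly p) (at y) v)"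
          by (simp add: box_norm_def frechet_derivative_poly norm_mult mult_ac)
      qed
    qed
    also have "\<dots> \<longleftrightarrow> L / ?m * \<phi> k \<le> \<phi> j" using pos(1) by (simp add: field_simps)
    finally show ?thesis .
  qed
  then show ?thesis unfolding box_expansive_def feasible_def by (intro ball_cong) auto
qed

section \<open>Correctness of the algorithm for every sequence of choices\<close>

text \<open>The first conjunct shows that admissible choices exist for every root, so the second is
  not vacuous; \<open>Some\<close> in the second asserts termination. The hypothesis
  \<open>weights_defined\<close> is what makes the weights meaningful: in HOL, division by a zero
  multiplier would give weight 0 and no constraint, although no positive handicaps expand an edge
  whose source box contains a critical point.\<close>

theorem theorem1p5:
  fixes p :: "complex poly" and N :: nat and B :: "nat \<Rightarrow> complex set"
    and \<Gamma> :: "nat pair_pre_digraph" and L :: real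
  assumes "degree p > 1"
    and "box_chain_model (poly p) N B \<Gamma>"
    and "L > 0"
    and weights_defined: "\<forall>(k, j)\<in>parcs \<Gamma>. multiplier (poly p) (B k) \<noteq> 0"
  shows "(\<forall>v0\<in>pverts \<Gamma>. \<exists>ts es ord. hha_choices \<Gamma> v0 ts es ord) \<and>
    (\<forall>v0 ts es ord. hha_choices \<Gamma> v0 ts es ord \<longrightarrow>
      (\<exists>\<phi>. handicap_hedging (poly p) B L v0 ts es ord = Some (Return1 \<phi>) \<and>
           box_metric (pverts \<Gamma>) \<phi> \<and> box_expansive (poly p) B (parcs \<Gamma>) L \<phi>) \<or>
      (\<exists>c. handicap_hedging (poly p) B L v0 ts es ord = Some (Return0 c) \<and>
           obstruction (poly p) B \<Gamma> L c \<and>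
           \<not> (\<exists>\<phi>. box_metric (pverts \<Gamma>) \<phi> \<and> box_expansive (poly p) B (parcs \<Gamma>) L \<phi>)))"
proof (intro conjI ballI allI impI)
  have V: "pverts \<Gamma> = {1..N}" and wf: "pair_wf_digraph \<Gamma>" and boxes: "\<And>k. k \<in> {1..N} \<Longrightarrow> closed_box (B k)"
    and conn: "strongly_connected (with_proj \<Gamma>)"
    using assms(2) by (auto simp: box_chain_model_def)
  interpret pair_wf_digraph \<Gamma> by fact
  have arcs: "parcs \<Gamma> \<subseteq> pverts \<Gamma> \<times> pverts \<Gamma>" using in_arcsD1 in_arcsD2 by auto
  have fin: "finite (pverts \<Gamma>)" by (simp add: V)
  show "\<exists>ts es ord. hha_choices \<Gamma> v0 ts es ord" if "v0 \<in> pverts \<Gamma>" for v0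
    using hha_choices_exist[OF wf fin conn that] .
  fix v0 ts es ord assume choices: "hha_choices \<Gamma> v0 ts es ord"
  define \<xi> where "\<xi> = (\<lambda>k j :: nat. L / multiplier (poly p) (B k))"
  have box: "closed_box (B k) \<and> multiplier (poly p) (B k) > 0" if "(k, j) \<in> parcs \<Gamma>" for k j
  proof -
    have b: "closed_box (B k)" using boxes that arcs V by auto
    then obtain z where "multiplier (poly p) (B k) = cmod (poly (pderiv p) z)" by (rule multiplier_attained)
    moreover have "multiplier (poly p) (B k) \<noteq> 0" using weights_defined that by auto
    ultimately show ?thesis using b by auto
  qed
  have \<xi>_pos: "\<xi> k j > 0" if "(k, j) \<in> parcs \<Gamma>" for k j
    using box[OF that] \<open>L > 0\<close> by (simp add: \<xi>_def)
  have expansive_iff: "box_expansive (poly p) B E L \<phi> \<longleftrightarrow> feasible \<xi> E \<phi>"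
    if "E \<subseteq> parcs \<Gamma>" "box_metric (pverts \<Gamma>) \<phi>" for E \<phi>
    unfolding \<xi>_def using that box in_arcsD2 by (intro box_expansive_iff_feasible) (auto simp: box_metric_def)
  let ?\<phi> = "init_handicaps \<xi> v0 ts"
  have ts: "spanning_arborescence \<Gamma> v0 \<lparr>pverts = pverts \<Gamma>, parcs = set ts\<rparr>" "distinct ts" "outward v0 ts"
    and ord: "\<And>E \<phi> v. E \<subseteq> parcs \<Gamma> \<Longrightarrow> set (ord E \<phi> v) = E `` {v}"
    and es: "set es = parcs \<Gamma> - set ts"
    using choices by (auto simp: hha_choices_def)
  have "set ts \<subseteq> parcs \<Gamma>"
    using ts(1) by (auto simp: spanning_arborescence_def spanning_def subgraph_def)
  then have all: "set ts \<union> set es = parcs \<Gamma>" using es by auto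
  \<comment> \<open>Whatever arborescence was chosen, its list has distinct heads and covers all
    vertices, so the initial handicaps are positive everywhere and satisfy the tree
    inequalities.\<close>
  have init: "\<forall>x\<in>pverts \<Gamma>. ?\<phi> x > 0" "feasible \<xi> (set ts) ?\<phi>"
    using init_handicaps_outward[OF ts(3) spanning_arborescenceD(1)[OF ts(1,2)], of \<xi>] \<xi>_pos \<open>set ts \<subseteq> parcs \<Gamma>\<close>
    unfolding spanning_arborescenceD(2)[OF ts(1,2)] by auto
  have run: "handicap_hedging (poly p) B L v0 ts es ord = add_edges \<xi> ord (set ts) es ?\<phi>"
    by (simp add: handicap_hedging_def \<xi>_def Let_def)
  consider (metric) \<psi> where "add_edges \<xi> ord (set ts) es ?\<phi> = Some (Return1 \<psi>)" "?\<phi> \<le> \<psi>" "feasible \<xi> (parcs \<Gamma>) \<psi>"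
    | (cycle) c u where "add_edges \<xi> ord (set ts) es ?\<phi> = Some (Return0 c)" "c \<noteq> []" "pcas u c u"
      "set c \<subseteq> parcs \<Gamma>" "distinct (map snd c)" "1 < prod_list (map (case_prod \<xi>) c)"
    using add_edges_cases[of "pverts \<Gamma>" "set ts" es \<xi> ?\<phi> ord] fin arcs \<xi>_pos init ord unfolding all by blast
  then show "(\<exists>\<phi>. handicap_hedging (poly p) B L v0 ts es ord = Some (Return1 \<phi>) \<and>
           box_metric (pverts \<Gamma>) \<phi> \<and> box_expansive (poly p) B (parcs \<Gamma>) L \<phi>) \<or>
      (\<exists>c. handicap_hedging (poly p) B L v0 ts es ord = Some (Return0 c) \<and>
           obstruction (poly p) B \<Gamma> L c \<and>
           \<not> (\<exists>\<phi>. box_metric (pverts \<Gamma>) \<phi> \<and> box_expansive (poly p) B (parcs \<Gamma>) L \<phi>))"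
  proof cases
    case metric
    have "box_metric (pverts \<Gamma>) \<psi>"
      using init(1) metric(2) unfolding box_metric_def by (meson le_fun_def less_le_trans)
    then show ?thesis using metric run expansive_iff by auto
  next
    case cycle
    have u: "u \<in> pverts \<Gamma>" using pcas_end_in_heads[OF cycle(3,2)] cycle(4) arcs by auto
    \<comment> \<open>Going once around the cycle would give a product above 1 times
      \<open>\<phi> u\<close> at most \<open>\<phi> u\<close>, which is impossible for positive
      \<open>\<phi> u\<close>.\<close>
    have no_metric: False if "box_metric (pverts \<Gamma>) \<phi>" "box_expansive (poly p) B (set c) L \<phi>" for \<phi>
    proof -
      have "feasible \<xi> (set c) \<phi>" using expansive_iff[OF cycle(4) that(1)] that(2) by simp
      moreover have "\<xi> x y \<ge> 0" if "(x, y) \<in> set c" for x y using that cycle(4) \<xi>_pos less_imp_le by blast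
      ultimately have "prod_list (map (case_prod \<xi>) c) * \<phi> u \<le> \<phi> u" using feasible_walk[OF cycle(3)] by blast
      moreover have "\<phi> u > 0" using that(1) u by (simp add: box_metric_def)
      ultimately show False using cycle(6) by simp
    qed
    moreover have "box_expansive (poly p) B (set c) L \<phi>" if "box_expansive (poly p) B (parcs \<Gamma>) L \<phi>" for \<phi>
      using that cycle(4) unfolding box_expansive_def by blast
    moreover have "pre_digraph.cycle (with_proj \<Gamma>) c"
      using cycle u by (auto simp: cycle_with_proj_iff)
    ultimately show ?thesis using cycle(1) run unfolding obstruction_def by metis
  qed
qed

end
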